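(* Let $\Omega=(0,1)^2\subset\mathbb{R}^2$, let $\Gamma_D=\{(x_1,x_2)\in\partial\Omega : x_1\in\{0,1\},\ x_2\in(0,1)\}$ with closure $\overline{\Gamma_D}$, and let $\Gamma_N=\{(x_1,x_2)\in\partial\Omega : x_1\in(0,1),\ x_2\in\{0,1\}\}$, so that $\overline{\Gamma_D}$ and $\Gamma_N$ partition $\partial\Omega$. For a fixed but arbitrary constant $c>0$, let the locally bounded function $v_c:\overline{\Omega}\to\mathbb{R}$ be defined by $v_c=0$ on $\Omega\cup\Gamma_N$ and $v_c=-c$ on $\overline{\Gamma_D}$. Then $v_c$ is a viscosity solution, in the sense of Barles--Souganidis, of the mixed boundary value problem $$H(D^2u)=0\ \text{ in }\Omega,\qquad u=0\ \text{ on }\Gamma_D,\qquad \nabla u\cdot n=0\ \text{ on }\Gamma_N,$$ where $H(A)=\sup_{B\in\mathcal{S}_1}(-B:A)$ (the Hamilton--Jacobi--Bellman form of the Monge--Ampère equation with vanishing source term $f=0$).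
   Context: $\mathcal{S}_1$ is the set of symmetric positive semidefinite matrices in $\mathbb{R}^{2\times 2}$ with trace equal to $1$, and $B:A=\sum_{i,j}B_{ij}A_{ij}$. For general $f\ge 0$ the Hamilton--Jacobi--Bellman operator is $H(A)=\sup_{B\in\mathcal{S}_1}(-B:A+f\sqrt{\det B})$; here $f=0$. For a locally bounded function $v:\overline{\Omega}\to\mathbb{R}$, its upper and lower semicontinuous envelopes on $\overline{\Omega}$ are $$v^*(x)=\sup_{\{y_n\}\subset\overline{\Omega},\ y_n\to x}\ \limsup_{n\to\infty}v(y_n),\qquad v_*(x)=\inf_{\{y_n\}\subset\overline{\Omega},\ y_n\to x}\ \liminf_{n\to\infty}v(y_n),$$ the supremum and infimum being over all sequences in $\overline\Omega$ converging to $x$. Let $n_{\Gamma_N}$ be the unit outward normal of the Neumann part of the boundary: $n_{\Gamma_N}=(0,1)$ where $x_2=1$ and $n_{\Gamma_N}=(0,-1)$ where $x_2=0$ (this is also used at the four corner points, which form the set $\partial\Omega\setminus(\Gamma_D\cup\Gamma_N)$). For $p\in\mathbb{R}^2$, $r\in\mathbb{R}$, $x\in\partial\Omega$ set $B(p,r,x)=r$ if $x\in\overline{\Gamma_D}$ and $B(p,r,x)=p\cdot n_{\Gamma_N}$ if $x\in\Gamma_N$. Its lower and upper envelopes are $$B_*(p,r,x)=\begin{cases}B(p,r,x), & x\in\Gamma_D\cup\Gamma_N,\\ \min\{r,p\cdot n_{\Gamma_N}\}, & x\in\partial\Omega\setminus(\Gamma_D\cup\Gamma_N),\end{cases}$$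 $$B^*(p,r,x)=\begin{cases}B(p,r,x), & x\in\Gamma_D\cup\Gamma_N,\\ \max\{r,p\cdot n_{\Gamma_N}\}, & x\in\partial\Omega\setminus(\Gamma_D\cup\Gamma_N).\end{cases}$$ For symmetric $A\in\mathbb{R}^{2\times2}$, $p\in\mathbb{R}^2$, $w\in\mathbb{R}$, $x\in\overline{\Omega}$ define $$F_*(A,p,w,x)=\begin{cases}H(A), & x\in\Omega,\\ \min\{H(A),B_*(p,w,x)\}, & x\in\partial\Omega,\end{cases}$$ $$F^*(A,p,w,x)=\begin{cases}H(A), & x\in\Omega,\\ \max\{H(A),B^*(p,w,x)\}, & x\in\partial\Omega.\end{cases}$$ In the sense of Barles--Souganidis: a locally bounded function $v$ is a viscosity subsolution of the mixed boundary value problem if $F_*(D^2\phi(x),\nabla\phi(x),v^*(x),x)\le 0$ for all $\phi\in C^2(\overline{\Omega})$ such that $v^*-\phi$ has a local maximum (relative to $\overline\Omega$) at $x\in\overline{\Omega}$. It is a viscosity supersolution if $F^*(D^2\phi(x),\nabla\phi(x),v_*(x),x)\ge 0$ for all $\phi\in C^2(\overline{\Omega})$ such that $v_*-\phi$ has a local minimum (relative to $\overline\Omega$) at $x\in\overline{\Omega}$. It is a viscosity solution if it is both a viscosity subsolution and a viscosity supersolution. *)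

theory Defs
  imports "HOL-Analysis.Analysis"
begin

definition Omega :: "(real^2) set" where
  "Omega = {x. 0 < x$1 \<and> x$1 < 1 \<and> 0 < x$2 \<and> x$2 < 1}"

definition Gamma_D :: "(real^2) set" where
  "Gamma_D = {x \<in> frontier Omega. x$1 \<in> {0, 1} \<and> x$2 \<in> {0<..<1}}"

definition Gamma_N :: "(real^2) set" where
  "Gamma_N = {x \<in> frontier Omega. x$1 \<in> {0<..<1} \<and> x$2 \<in> {0, 1}}"

definition S1 :: "(real^2^2) set" where
  "S1 = {B. transpose B = B \<and> (\<forall>x. 0 \<le> x \<bullet> (B *v x)) \<and> trace B = 1}"

definition frob :: "real^2^2 \<Rightarrow> real^2^2 \<Rightarrow> real" where
  "frob B A = (\<Sum>i\<in>UNIV. \<Sum>j\<in>UNIV. B$i$j * A$i$j)"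

text \<open>The Hamilton--Jacobi--Bellman operator with source term \<open>f = 0\<close>. The supremum is
  that of a nonempty bounded set, since \<open>S1\<close> is nonempty and compact.\<close>

definition HJB :: "real^2^2 \<Rightarrow> real" where
  "HJB A = (SUP B\<in>S1. - frob B A)"

text \<open>Functions on \<open>closure Omega\<close> are represented by total functions; nothing below
  depends on their values off \<open>closure Omega\<close>.\<close>

definition locally_bounded_on :: "(real^2) set \<Rightarrow> (real^2 \<Rightarrow> real) \<Rightarrow> bool" where
  "locally_bounded_on S v \<longleftrightarrow> (\<forall>x\<in>S. \<exists>e>0. bounded (v ` (S \<inter> ball x e)))"

definition seqs_to :: "real^2 \<Rightarrow> (nat \<Rightarrow> real^2) set" where
  "seqs_to x = {y. (\<forall>n. y n \<in> closure Omega) \<and> y \<longlonglongrightarrow> x}"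

text \<open>Superior and inferior limits are taken in the extended reals. For locally bounded \<open>v\<close>
  and \<open>x\<close> in \<open>closure Omega\<close> the extremum is finite, so \<open>real_of_ereal\<close> loses nothing.\<close>

definition usc_env :: "(real^2 \<Rightarrow> real) \<Rightarrow> real^2 \<Rightarrow> real" where
  "usc_env v x = real_of_ereal (SUP y\<in>seqs_to x. limsup (\<lambda>n. ereal (v (y n))))"

definition lsc_env :: "(real^2 \<Rightarrow> real) \<Rightarrow> real^2 \<Rightarrow> real" where
  "lsc_env v x = real_of_ereal (INF y\<in>seqs_to x. liminf (\<lambda>n. ereal (v (y n))))"

text \<open>The outward normal of the Neumann part, used only where \<open>x$2\<close> is 0 or 1.\<close>

definition normal_N :: "real^2 \<Rightarrow> real^2" where
  "normal_N x = (if x$2 = 1 then vector [0, 1] else vector [0, -1])"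

text \<open>The boundary operators are meant for \<open>x\<close> in \<open>frontier Omega\<close>, where the complement of
  \<open>closure Gamma_D\<close> is \<open>Gamma_N\<close>.\<close>

definition bdry :: "real^2 \<Rightarrow> real \<Rightarrow> real^2 \<Rightarrow> real" where
  "bdry p r x = (if x \<in> closure Gamma_D then r else p \<bullet> normal_N x)"

definition bdry_lower :: "real^2 \<Rightarrow> real \<Rightarrow> real^2 \<Rightarrow> real" where
  "bdry_lower p r x =
    (if x \<in> Gamma_D \<union> Gamma_N then bdry p r x else min r (p \<bullet> normal_N x))"

definition bdry_upper :: "real^2 \<Rightarrow> real \<Rightarrow> real^2 \<Rightarrow> real" where
  "bdry_upper p r x =
    (if x \<in> Gamma_D \<union> Gamma_N then bdry p r x else max r (p \<bullet> normal_N x))"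

definition F_lower :: "real^2^2 \<Rightarrow> real^2 \<Rightarrow> real \<Rightarrow> real^2 \<Rightarrow> real" where
  "F_lower A p w x = (if x \<in> Omega then HJB A else min (HJB A) (bdry_lower p w x))"

definition F_upper :: "real^2^2 \<Rightarrow> real^2 \<Rightarrow> real \<Rightarrow> real^2 \<Rightarrow> real" where
  "F_upper A p w x = (if x \<in> Omega then HJB A else max (HJB A) (bdry_upper p w x))"

text \<open>\<open>C2_closure \<phi> g h\<close>: \<open>\<phi>\<close> is of class \<open>C\<^sup>2\<close> on \<open>closure Omega\<close>, i.e. \<open>\<phi>\<close> is twice
  differentiable in \<open>Omega\<close>, and \<open>\<phi>\<close>, its gradient and its Hessian extend continuously to
  \<open>closure Omega\<close>; \<open>g\<close> and \<open>h\<close> are these extensions, which \<open>\<phi>\<close> determines uniquely on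
  \<open>closure Omega\<close>.\<close>

definition C2_closure ::
  "(real^2 \<Rightarrow> real) \<Rightarrow> (real^2 \<Rightarrow> real^2) \<Rightarrow> (real^2 \<Rightarrow> real^2^2) \<Rightarrow> bool" where
  "C2_closure \<phi> g h \<longleftrightarrow>
    (\<forall>x\<in>Omega. (\<phi> has_derivative (\<lambda>y. g x \<bullet> y)) (at x)) \<and>
    (\<forall>x\<in>Omega. (g has_derivative (\<lambda>y. h x *v y)) (at x)) \<and>
    continuous_on (closure Omega) \<phi> \<and>
    continuous_on (closure Omega) g \<and>
    continuous_on (closure Omega) h"

definition local_max_on :: "(real^2) set \<Rightarrow> (real^2 \<Rightarrow> real) \<Rightarrow> real^2 \<Rightarrow> bool" where
  "local_max_on S f x \<longleftrightarrow> x \<in> S \<and> (\<exists>e>0. \<forall>y\<in>S \<inter> ball x e. f y \<le> f x)"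

definition local_min_on :: "(real^2) set \<Rightarrow> (real^2 \<Rightarrow> real) \<Rightarrow> real^2 \<Rightarrow> bool" where
  "local_min_on S f x \<longleftrightarrow> x \<in> S \<and> (\<exists>e>0. \<forall>y\<in>S \<inter> ball x e. f x \<le> f y)"

definition viscosity_subsolution :: "(real^2 \<Rightarrow> real) \<Rightarrow> bool" where
  "viscosity_subsolution v \<longleftrightarrow>
    locally_bounded_on (closure Omega) v \<and>
    (\<forall>\<phi> g h. C2_closure \<phi> g h \<longrightarrow>
      (\<forall>x. local_max_on (closure Omega) (\<lambda>y. usc_env v y - \<phi> y) x \<longrightarrow>
        F_lower (h x) (g x) (usc_env v x) x \<le> 0))"

definition viscosity_supersolution :: "(real^2 \<Rightarrow> real) \<Rightarrow> bool" where
  "viscosity_supersolution v \<longleftrightarrow>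
    locally_bounded_on (closure Omega) v \<and>
    (\<forall>\<phi> g h. C2_closure \<phi> g h \<longrightarrow>
      (\<forall>x. local_min_on (closure Omega) (\<lambda>y. lsc_env v y - \<phi> y) x \<longrightarrow>
        F_upper (h x) (g x) (lsc_env v x) x \<ge> 0))"

definition viscosity_solution :: "(real^2 \<Rightarrow> real) \<Rightarrow> bool" where
  "viscosity_solution v \<longleftrightarrow> viscosity_subsolution v \<and> viscosity_supersolution v"

end

theory Submission
  imports Defs
begin

text \<open>
  The boundary value \<open>-c\<close> goes unnoticed because the envelopes separate two roles. The value 0 is
  approached from \<open>Omega\<close> at every point, so the upper envelope of \<open>v\<close> vanishes on the whole closed
  square, while \<open>v\<close> is lower semicontinuous and hence its own lower envelope
  (\<open>usc_env_eq\<close>, \<open>lsc_env_eq\<close>).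

  For the subsolution property, a test function thus has a local minimum relative to the closed
  square. In the interior its Hessian is positive semidefinite, which makes the operator
  nonpositive; on \<open>Gamma_N\<close> its derivative in the inward direction is nonnegative; on the closure of
  \<open>Gamma_D\<close> the Dirichlet alternative holds because the upper envelope is 0 there.

  On the Dirichlet edges the supersolution property cannot come from the boundary condition, since
  \<open>-c < 0\<close>. It comes from the degeneracy of the operator: to make it nonnegative it is enough that
  the Hessian is nonpositive in one single direction (\<open>HJB_nonneg\<close>). As \<open>v\<close> depends on the first
  coordinate alone, it is constant along the vertical segment through any point, and a test function
  has a local maximum relative to that segment. At a relative interior point of the segment its
  second vertical derivative is nonpositive; at an endpoint its outward normal derivative is
  nonnegative, which settles \<open>Gamma_N\<close> as well as the corners, where the Neumann condition enters
  the maximum that defines the upper boundary operator.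

  Both halves use the necessary conditions for a minimum relative to a convex subset of the closed
  square (\<open>gradient_at_local_min\<close>, \<open>Hessian_at_local_min\<close>). The subset may lie inside the boundary,
  where the gradient and the Hessian of a test function are only continuous extensions and not
  derivatives; what links them to the test function there is a second-order Taylor expansion that
  holds up to the boundary (\<open>Taylor_Peano_closure\<close>).
\<close>

section \<open>Geometry of the square\<close>

lemma Omega_eq_box: "Omega = box 0 1"
  by (auto simp: Omega_def mem_box_cart forall_2)

lemma mem_Omega: "x \<in> Omega \<longleftrightarrow> 0 < x$1 \<and> x$1 < 1 \<and> 0 < x$2 \<and> x$2 < 1"
  by (simp add: Omega_def)

lemma closure_Omega: "closure Omega = cbox 0 1"
  unfolding Omega_eq_box
  by (rule closure_box) (auto simp: box_ne_empty Basis_vec_def inner_axis)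

lemma open_Omega: "open Omega"
  by (simp add: Omega_eq_box open_box)

lemma mem_closure_Omega:
  "x \<in> closure Omega \<longleftrightarrow> 0 \<le> x$1 \<and> x$1 \<le> 1 \<and> 0 \<le> x$2 \<and> x$2 \<le> 1"
  by (auto simp: closure_Omega mem_box_cart forall_2)

lemma mem_frontier_Omega:
  "x \<in> frontier Omega \<longleftrightarrow> x \<in> closure Omega \<and> (x$1 \<in> {0, 1} \<or> x$2 \<in> {0, 1})"
  unfolding frontier_def interior_open[OF open_Omega] Diff_iff mem_closure_Omega
  by (auto simp: mem_Omega)

lemma closure_Gamma_D:
  "closure Gamma_D = {x. x$1 \<in> {0, 1} \<and> 0 \<le> x$2 \<and> x$2 \<le> 1}" (is "_ = ?E")
proof
  have "{x :: real^2. x$1 \<in> {0, 1} \<and> 0 \<le> x$2 \<and> x$2 \<le> 1} =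
      ({x. x$1 = 0} \<union> {x. x$1 = 1}) \<inter> {x. 0 \<le> x$2} \<inter> {x. x$2 \<le> 1}"
    by auto
  moreover have "closed \<dots>"
    by (intro closed_Int closed_Un closed_Collect_eq closed_Collect_le continuous_intros)
  ultimately have "closed ?E"
    by simp
  moreover have "Gamma_D \<subseteq> ?E"
    by (auto simp: Gamma_D_def)
  ultimately show "closure Gamma_D \<subseteq> ?E"
    by (rule closure_minimal[rotated])
next
  show "?E \<subseteq> closure Gamma_D"
  proof
    fix x assume x: "x \<in> ?E"
    \<comment> \<open>\<open>?f\<close> runs along the vertical line through \<open>x\<close>: it maps the open interval into \<open>Gamma_D\<close>,
      hence the closed one into the closure.\<close>
    let ?f = "\<lambda>t. (\<chi> i. if i = 1 then x$1 else t) :: real^2"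
    have "continuous_on (closure {0<..<1}) ?f"
    proof (rule continuous_on_vec_lambda)
      show "continuous_on (closure {0<..<1}) (\<lambda>t. if i = 1 then x$1 else t)" for i :: 2
        by (cases "i = 1") simp_all
    qed
    moreover have "?f ` {0<..<1} \<subseteq> closure Gamma_D"
      using x closure_subset[of Gamma_D]
      by (auto simp: Gamma_D_def mem_frontier_Omega mem_closure_Omega)
    ultimately have "?f ` closure {0<..<1} \<subseteq> closure Gamma_D"
      by (intro image_closure_subset) auto
    moreover have "x = ?f (x$2)"
      by (simp add: vec_eq_iff forall_2)
    ultimately show "x \<in> closure Gamma_D"
      using x by auto
  qed
qed

lemma mem_Gamma_N: "x \<in> Gamma_N \<longleftrightarrow> 0 < x$1 \<and> x$1 < 1 \<and> x$2 \<in> {0, 1}"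
  by (auto simp: Gamma_N_def mem_frontier_Omega mem_closure_Omega)

lemma boundary_partition:
  "closure Gamma_D \<union> Gamma_N = frontier Omega" "closure Gamma_D \<inter> Gamma_N = {}"
  by (auto simp: closure_Gamma_D mem_Gamma_N mem_frontier_Omega mem_closure_Omega)

lemma closure_Omega_partition: "closure Omega = Omega \<union> Gamma_N \<union> closure Gamma_D"
  by (auto simp: closure_Gamma_D mem_Gamma_N mem_closure_Omega mem_Omega)

text \<open>The square has side length 1, so the inward unit normal at a point of a horizontal edge leads
  straight across to the opposite edge. This is the feasible direction for the Neumann condition.\<close>

lemma minus_normal_N:
  assumes "x \<in> closure Omega" "x$2 \<in> {0, 1}"
  shows "x - normal_N x \<in> closure Omega" "(x - normal_N x)$1 = x$1"
  using assms by (auto simp: normal_N_def mem_closure_Omega)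

section \<open>Second-order calculus up to the boundary\<close>

lemma norm_matrix_vector_mult_le:
  fixes A :: "real^'n^'m"
  shows "norm (A *v x) \<le> norm A * norm x"
proof -
  have "norm (A *v x) = L2_set (\<lambda>i. \<bar>A$i \<bullet> x\<bar>) UNIV"
    by (simp add: norm_vec_def matrix_vector_mul_component)
  also have "\<dots> \<le> L2_set (\<lambda>i. norm (A$i) * norm x) UNIV"
    by (intro L2_set_mono) (auto simp: Cauchy_Schwarz_ineq2)
  also have "\<dots> = norm A * norm x"
    by (simp add: norm_vec_def[of A] L2_set_left_distrib)
  finally show ?thesis .
qed

lemma quadratic_form_diff_le:
  fixes A B :: "real^'n^'n"
  shows "\<bar>\<xi> \<bullet> (A *v \<xi>) - \<xi> \<bullet> (B *v \<xi>)\<bar> \<le> norm (A - B) * (norm \<xi>)\<^sup>2"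
proof -
  have "\<bar>\<xi> \<bullet> (A *v \<xi>) - \<xi> \<bullet> (B *v \<xi>)\<bar> = \<bar>\<xi> \<bullet> ((A - B) *v \<xi>)\<bar>"
    by (simp add: matrix_vector_mult_diff_rdistrib inner_diff_right)
  also have "\<dots> \<le> norm \<xi> * norm ((A - B) *v \<xi>)"
    by (rule Cauchy_Schwarz_ineq2)
  also have "\<dots> \<le> norm \<xi> * (norm (A - B) * norm \<xi>)"
    by (intro mult_left_mono norm_matrix_vector_mult_le) auto
  finally show ?thesis
    by (simp add: power2_eq_square mult_ac)
qed

lemma C2_closure_minus:
  assumes "C2_closure \<phi> g h"
  shows "C2_closure (\<lambda>x. - \<phi> x) (\<lambda>x. - g x) (\<lambda>x. - h x)"
proof -
  have *: "- M *v y = - (M *v y)" for M :: "real^2^2" and y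
    using matrix_vector_mult_diff_rdistrib[of 0 M y] by simp
  show ?thesis
    using assms unfolding C2_closure_def * inner_minus_left
    by (intro conjI ballI continuous_intros has_derivative_minus) simp_all
qed

text \<open>The open square is convex, so Taylor's theorem in one variable applies along the segment from
  \<open>x\<close> to \<open>y\<close>.\<close>

lemma Taylor_interior:
  assumes C2: "C2_closure \<phi> g h" and x: "x \<in> Omega" and y: "y \<in> Omega"
  obtains z where "z \<in> closed_segment x y"
    "\<phi> y = \<phi> x + g x \<bullet> (y - x) + (y - x) \<bullet> (h z *v (y - x)) / 2"
proof -
  define \<xi> where "\<xi> = y - x"
  have seg: "x + t *\<^sub>R \<xi> \<in> closed_segment x y" if "0 \<le> t" "t \<le> 1" for t
    using that by (auto simp: in_segment \<xi>_def algebra_simps intro!: exI[of _ t])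
  have "closed_segment x y \<subseteq> Omega"
    using x y by (intro closed_segment_subset) (auto simp: Omega_eq_box)
  then have in_Omega: "x + t *\<^sub>R \<xi> \<in> Omega" if "0 \<le> t" "t \<le> 1" for t
    using seg that by blast
  have line: "((\<lambda>t. x + t *\<^sub>R \<xi>) has_derivative (\<lambda>s. s *\<^sub>R \<xi>)) (at t)" for t
    by (auto intro!: derivative_eq_intros)
  have d1: "((\<lambda>t. \<phi> (x + t *\<^sub>R \<xi>)) has_real_derivative g (x + t *\<^sub>R \<xi>) \<bullet> \<xi>) (at t)"
    if "0 \<le> t" "t \<le> 1" for t
  proof -
    have "(\<phi> has_derivative (\<lambda>y. g (x + t *\<^sub>R \<xi>) \<bullet> y)) (at (x + t *\<^sub>R \<xi>))"
      using C2 in_Omega[OF that] by (auto simp: C2_closure_def)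
    from has_derivative_compose[OF line this] show ?thesis
      by (auto simp: has_field_derivative_def mult.commute[of "_ \<bullet> _"] fun_eq_iff
          elim!: has_derivative_eq_rhs)
  qed
  have d2: "((\<lambda>t. g (x + t *\<^sub>R \<xi>) \<bullet> \<xi>) has_real_derivative
      \<xi> \<bullet> (h (x + t *\<^sub>R \<xi>) *v \<xi>)) (at t)" if "0 \<le> t" "t \<le> 1" for t
  proof -
    have "(g has_derivative (\<lambda>y. h (x + t *\<^sub>R \<xi>) *v y)) (at (x + t *\<^sub>R \<xi>))"
      using C2 in_Omega[OF that] by (auto simp: C2_closure_def)
    from has_derivative_inner_left[OF has_derivative_compose[OF line this], of \<xi>] show ?thesis
      by (auto simp: has_field_derivative_def matrix_vector_mult_scaleR fun_eq_iff
          inner_commute[of "_ *v _"] mult.commute[of "_ \<bullet> _"] elim!: has_derivative_eq_rhs)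
  qed
  let ?d = "\<lambda>m::nat. \<lambda>t. if m = 0 then \<phi> (x + t *\<^sub>R \<xi>)
    else if m = 1 then g (x + t *\<^sub>R \<xi>) \<bullet> \<xi> else \<xi> \<bullet> (h (x + t *\<^sub>R \<xi>) *v \<xi>)"
  have "\<exists>t>0. t < 1 \<and> \<phi> (x + 1 *\<^sub>R \<xi>) =
      (\<Sum>m<2. ?d m 0 / fact m * (1 - 0) ^ m) + ?d 2 t / fact 2 * (1 - 0) ^ 2"
    by (rule Taylor_up[where a = 0 and b = 1]) (auto simp: less_2_cases_iff d1 d2)
  then obtain t where t: "0 < t" "t < 1"
    and eq: "\<phi> (x + \<xi>) = \<phi> x + g x \<bullet> \<xi> + \<xi> \<bullet> (h (x + t *\<^sub>R \<xi>) *v \<xi>) / 2"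
    by (auto simp: numeral_2_eq_2)
  show ?thesis
    using that[OF seg[of t]] t eq by (simp add: \<xi>_def)
qed

text \<open>Near \<open>x\<close> the Hessian is within \<open>\<epsilon>\<close> of \<open>h x\<close>, so the expansion around an interior point \<open>p\<close>,
  with \<open>h x\<close> in place of the intermediate Hessian, has an error of at most \<open>\<epsilon> |q - p|\<^sup>2 / 2\<close> at any
  other interior point \<open>q\<close>. This bound involves only functions that are continuous on the closed
  square, hence it survives the limit \<open>p \<rightarrow> x\<close>, \<open>q \<rightarrow> y\<close> even when the segment from \<open>x\<close> to \<open>y\<close> lies in
  the boundary.\<close>

lemma Taylor_Peano_closure:
  assumes C2: "C2_closure \<phi> g h" and x: "x \<in> closure Omega" and "\<epsilon> > 0"
  obtains \<delta> where "\<delta> > 0"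
    "\<And>y. \<lbrakk>y \<in> closure Omega; dist x y < \<delta>\<rbrakk> \<Longrightarrow>
      \<bar>\<phi> y - \<phi> x - g x \<bullet> (y - x) - (y - x) \<bullet> (h x *v (y - x)) / 2\<bar> \<le> \<epsilon> * (dist x y)\<^sup>2"
proof -
  have cont: "continuous_on (closure Omega) \<phi>" "continuous_on (closure Omega) g"
      "continuous_on (closure Omega) h"
    using C2 by (auto simp: C2_closure_def)
  obtain \<delta> where "\<delta> > 0"
    and \<delta>: "\<And>z. \<lbrakk>z \<in> closure Omega; dist z x < \<delta>\<rbrakk> \<Longrightarrow> dist (h z) (h x) < \<epsilon>"
    using cont(3) x \<open>\<epsilon> > 0\<close> unfolding continuous_on_iff by meson
  let ?E = "\<lambda>p q. \<phi> q - \<phi> p - g p \<bullet> (q - p) - (q - p) \<bullet> (h x *v (q - p)) / 2"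
  have inside: "\<bar>?E p q\<bar> \<le> \<epsilon> * (norm (q - p))\<^sup>2"
    if pq: "p \<in> Omega" "q \<in> Omega" "p \<in> ball x \<delta>" "q \<in> ball x \<delta>" for p q
  proof -
    obtain z where z: "z \<in> closed_segment p q"
      and eq: "\<phi> q = \<phi> p + g p \<bullet> (q - p) + (q - p) \<bullet> (h z *v (q - p)) / 2"
      using Taylor_interior[OF C2 pq(1,2)] .
    have "closed_segment p q \<subseteq> Omega \<inter> ball x \<delta>"
      using pq by (intro closed_segment_subset convex_Int) (auto simp: Omega_eq_box)
    then have "z \<in> closure Omega" "dist z x < \<delta>"
      using z closure_subset[of Omega] by (auto simp: dist_commute)
    then have "norm (h z - h x) \<le> \<epsilon>"
      using \<delta>[of z] by (simp add: dist_norm)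
    then have "norm (h z - h x) * (norm (q - p))\<^sup>2 \<le> \<epsilon> * (norm (q - p))\<^sup>2"
      by (rule mult_right_mono) simp
    moreover have "?E p q = ((q - p) \<bullet> (h z *v (q - p)) - (q - p) \<bullet> (h x *v (q - p))) / 2"
      using eq by (simp add: field_simps)
    ultimately show ?thesis
      using quadratic_form_diff_le[of "q - p" "h z" "h x"] by (simp add: abs_if split: if_splits)
  qed
  show ?thesis
  proof (rule that[OF \<open>\<delta> > 0\<close>])
    fix y assume y: "y \<in> closure Omega" "dist x y < \<delta>"
    obtain p where p: "\<And>n. p n \<in> Omega" "p \<longlonglongrightarrow> x"
      using x unfolding closure_sequential by blast
    obtain q where q: "\<And>n. q n \<in> Omega" "q \<longlonglongrightarrow> y"
      using y unfolding closure_sequential by blast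
    have p': "p n \<in> closure Omega" and q': "q n \<in> closure Omega" for n
      using p(1) q(1) closure_subset by blast+
    have "(\<lambda>n. \<phi> (p n)) \<longlonglongrightarrow> \<phi> x" "(\<lambda>n. \<phi> (q n)) \<longlonglongrightarrow> \<phi> y" "(\<lambda>n. g (p n)) \<longlonglongrightarrow> g x"
      using continuous_on_tendsto_compose[OF cont(1) p(2) x]
        continuous_on_tendsto_compose[OF cont(1) q(2) y(1)]
        continuous_on_tendsto_compose[OF cont(2) p(2) x] p' q' by simp_all
    moreover have "(\<lambda>n. h x *v (q n - p n)) \<longlonglongrightarrow> h x *v (y - x)"
      by (intro bounded_linear.tendsto[OF matrix_vector_mul_bounded_linear] tendsto_diff p q)
    ultimately have lhs: "(\<lambda>n. \<bar>?E (p n) (q n)\<bar>) \<longlonglongrightarrow> \<bar>?E x y\<bar>"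
      by (intro tendsto_intros p(2) q(2)) auto
    have rhs: "(\<lambda>n. \<epsilon> * (norm (q n - p n))\<^sup>2) \<longlonglongrightarrow> \<epsilon> * (norm (y - x))\<^sup>2"
      by (intro tendsto_intros p(2) q(2))
    have "\<forall>\<^sub>F n in sequentially. p n \<in> ball x \<delta>" "\<forall>\<^sub>F n in sequentially. q n \<in> ball x \<delta>"
      using topological_tendstoD[OF p(2), of "ball x \<delta>"] \<open>\<delta> > 0\<close>
        topological_tendstoD[OF q(2), of "ball x \<delta>"] y by auto
    then have "\<forall>\<^sub>F n in sequentially. \<bar>?E (p n) (q n)\<bar> \<le> \<epsilon> * (norm (q n - p n))\<^sup>2"
      by eventually_elim (rule inside[OF p(1) q(1)])
    then have "\<bar>?E x y\<bar> \<le> \<epsilon> * (norm (y - x))\<^sup>2"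
      by (rule tendsto_le[OF sequentially_bot rhs lhs])
    then show "\<bar>?E x y\<bar> \<le> \<epsilon> * (dist x y)\<^sup>2"
      by (simp add: dist_norm norm_minus_commute)
  qed
qed

text \<open>The expansion, with its error bound, of the nonnegative number \<open>\<phi> (x + t *\<^sub>R \<xi>) - \<phi> x\<close>, divided
  by \<open>t\<close>. Letting \<open>t\<close> tend to 0 gives the first-order condition; when the linear term vanishes, a
  further division by \<open>t\<close> and the limit \<open>\<epsilon> \<rightarrow> 0\<close> give the second-order one.\<close>

lemma Taylor_at_local_min:
  assumes C2: "C2_closure \<phi> g h" and S: "convex S" "S \<subseteq> closure Omega"
    and min: "local_min_on S \<phi> x" and \<xi>: "x + \<xi> \<in> S" and "\<epsilon> > 0"
  shows "\<forall>\<^sub>F t in at_right 0. 0 \<le> g x \<bullet> \<xi> + t * (\<xi> \<bullet> (h x *v \<xi>) / 2 + \<epsilon> * (norm \<xi>)\<^sup>2)"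
proof -
  obtain e where "x \<in> S" "e > 0" and e: "\<And>y. y \<in> S \<Longrightarrow> dist x y < e \<Longrightarrow> \<phi> x \<le> \<phi> y"
    using min by (auto simp: local_min_on_def)
  obtain \<delta> where "\<delta> > 0" and \<delta>: "\<And>y. \<lbrakk>y \<in> closure Omega; dist x y < \<delta>\<rbrakk> \<Longrightarrow>
      \<bar>\<phi> y - \<phi> x - g x \<bullet> (y - x) - (y - x) \<bullet> (h x *v (y - x)) / 2\<bar> \<le> \<epsilon> * (dist x y)\<^sup>2"
    using Taylor_Peano_closure[OF C2 _ \<open>\<epsilon> > 0\<close>, of x] S(2) \<open>x \<in> S\<close> by blast
  have "((\<lambda>t. dist x (x + t *\<^sub>R \<xi>)) \<longlongrightarrow> dist x (x + 0 *\<^sub>R \<xi>)) (at_right 0)"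
    by (intro tendsto_intros)
  then have "\<forall>\<^sub>F t in at_right 0. dist x (x + t *\<^sub>R \<xi>) < min e \<delta>"
    by (rule order_tendstoD) (use \<open>e > 0\<close> \<open>\<delta> > 0\<close> in auto)
  moreover have "\<forall>\<^sub>F t in at_right (0::real). t \<in> {0<..<1}"
    by (rule eventually_at_right_real) simp
  ultimately show ?thesis
  proof eventually_elim
    case (elim t)
    let ?y = "x + t *\<^sub>R \<xi>"
    have "?y = (1 - t) *\<^sub>R x + t *\<^sub>R (x + \<xi>)"
      by (simp add: algebra_simps)
    then have "?y \<in> S"
      using convexD[OF S(1) \<open>x \<in> S\<close> \<xi>, of "1 - t" t] elim by auto
    then have "\<phi> x \<le> \<phi> ?y"
      using e elim by simp
    have "\<bar>\<phi> ?y - \<phi> x - g x \<bullet> (?y - x) - (?y - x) \<bullet> (h x *v (?y - x)) / 2\<bar>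
        \<le> \<epsilon> * (dist x ?y)\<^sup>2"
    proof (rule \<delta>)
      show "?y \<in> closure Omega"
        using \<open>?y \<in> S\<close> S(2) by auto
    qed (use elim in simp)
    with \<open>\<phi> x \<le> \<phi> ?y\<close> have "0 \<le> t * (g x \<bullet> \<xi>)
        + t\<^sup>2 * (\<xi> \<bullet> (h x *v \<xi>)) / 2 + \<epsilon> * (t\<^sup>2 * (norm \<xi>)\<^sup>2)"
      using elim by (simp add: matrix_vector_mult_scaleR dist_norm power_mult_distrib
          power2_eq_square abs_le_iff mult_ac)
    then have "0 \<le> t * (g x \<bullet> \<xi> + t * (\<xi> \<bullet> (h x *v \<xi>) / 2 + \<epsilon> * (norm \<xi>)\<^sup>2))"
      by (simp add: power2_eq_square algebra_simps)
    then show ?case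
      using elim by (simp add: zero_le_mult_iff)
  qed
qed

lemma gradient_at_local_min:
  assumes "C2_closure \<phi> g h" "convex S" "S \<subseteq> closure Omega"
    and "local_min_on S \<phi> x" "x + \<xi> \<in> S"
  shows "0 \<le> g x \<bullet> \<xi>"
proof -
  let ?b = "\<xi> \<bullet> (h x *v \<xi>) / 2 + 1 * (norm \<xi>)\<^sup>2"
  have "((\<lambda>t. g x \<bullet> \<xi> + t * ?b) \<longlongrightarrow> g x \<bullet> \<xi> + 0 * ?b) (at_right 0)"
    by (intro tendsto_intros)
  from tendsto_lowerbound[OF this Taylor_at_local_min[OF assms zero_less_one]] show ?thesis
    by simp
qed

lemma Hessian_at_local_min:
  assumes "C2_closure \<phi> g h" "convex S" "S \<subseteq> closure Omega"
    and "local_min_on S \<phi> x" "x + \<xi> \<in> S" "x - \<xi> \<in> S"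
  shows "0 \<le> \<xi> \<bullet> (h x *v \<xi>)"
proof -
  have "g x \<bullet> \<xi> = 0"
    using gradient_at_local_min[OF assms(1-5)] gradient_at_local_min[OF assms(1-4), of "- \<xi>"]
      assms(6) by simp
  have *: "0 \<le> \<xi> \<bullet> (h x *v \<xi>) / 2 + \<epsilon> * (norm \<xi>)\<^sup>2" if "\<epsilon> > 0" for \<epsilon>
  proof -
    have "\<forall>\<^sub>F t in at_right (0::real). 0 < t"
      by (rule eventually_at_right_less)
    with Taylor_at_local_min[OF assms(1-5) that]
    have "\<forall>\<^sub>F t in at_right (0::real). 0 \<le> \<xi> \<bullet> (h x *v \<xi>) / 2 + \<epsilon> * (norm \<xi>)\<^sup>2"
      by eventually_elim (simp add: \<open>g x \<bullet> \<xi> = 0\<close> zero_le_mult_iff)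
    then show ?thesis
      by simp
  qed
  have "((\<lambda>\<epsilon>. \<xi> \<bullet> (h x *v \<xi>) / 2 + \<epsilon> * (norm \<xi>)\<^sup>2) \<longlongrightarrow>
      \<xi> \<bullet> (h x *v \<xi>) / 2 + 0 * (norm \<xi>)\<^sup>2) (at_right 0)"
    by (intro tendsto_intros)
  moreover have "\<forall>\<^sub>F \<epsilon> in at_right 0. 0 \<le> \<xi> \<bullet> (h x *v \<xi>) / 2 + \<epsilon> * (norm \<xi>)\<^sup>2"
    using eventually_at_right_less[of "0::real"] by eventually_elim (rule *)
  ultimately show ?thesis
    using tendsto_lowerbound[of _ _ "at_right (0::real)" 0] by fastforce
qed

section \<open>The Hamilton--Jacobi--Bellman operator\<close>

lemma frob_2: "frob B A = B$1$1 * A$1$1 + B$1$2 * A$1$2 + B$2$1 * A$2$1 + B$2$2 * A$2$2"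
  by (simp add: frob_def sum_2)

lemma quadratic_form_2:
  fixes A :: "real^2^2"
  shows "y \<bullet> (A *v y) = y$1 * y$1 * A$1$1 + y$1 * y$2 * (A$1$2 + A$2$1) + y$2 * y$2 * A$2$2"
  by (simp add: inner_vec_def matrix_vector_mult_def sum_2 algebra_simps)

lemma S1_D:
  assumes "B \<in> S1"
  shows "B$2$1 = B$1$2" "B$1$1 + B$2$2 = 1" "0 \<le> B$1$1" "0 \<le> B$2$2"
    "(B$1$2)\<^sup>2 \<le> B$1$1 * B$2$2"
proof -
  show sym: "B$2$1 = B$1$2"
    using assms by (metis (mono_tags, lifting) S1_def mem_Collect_eq transpose_def vec_lambda_beta)
  show tr: "B$1$1 + B$2$2 = 1"
    using assms by (simp add: S1_def trace_def sum_2)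
  have psd: "0 \<le> y \<bullet> (B *v y)" for y
    using assms by (simp add: S1_def)
  have q: "0 \<le> a * a * B$1$1 + a * b * (B$1$2 + B$2$1) + b * b * B$2$2" for a b
    using psd[of "vector [a, b]"] by (simp add: quadratic_form_2)
  show "0 \<le> B$1$1" "0 \<le> B$2$2"
    using q[of 1 0] q[of 0 1] by auto
  show "(B$1$2)\<^sup>2 \<le> B$1$1 * B$2$2"
  proof -
    \<comment> \<open>At the rows of the adjugate the form takes the values \<open>B$2$2 * det B\<close> and \<open>B$1$1 * det B\<close>,
      whose sum is \<open>det B\<close> because the trace is 1.\<close>
    have "B$2$2 * (B$1$1 * B$2$2 - (B$1$2)\<^sup>2) \<ge> 0" "B$1$1 * (B$1$1 * B$2$2 - (B$1$2)\<^sup>2) \<ge> 0"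
      using q[of "B$2$2" "- B$1$2"] q[of "- B$1$2" "B$1$1"] sym
      by (simp_all add: algebra_simps power2_eq_square)
    then have "(B$1$1 + B$2$2) * (B$1$1 * B$2$2 - (B$1$2)\<^sup>2) \<ge> 0"
      unfolding distrib_right by linarith
    then show ?thesis
      using tr by simp
  qed
qed

lemma vertical_projection_in_S1: "(\<chi> i j. if i = 2 \<and> j = 2 then 1 else 0) \<in> S1"
proof -
  let ?P = "\<chi> i j. if i = 2 \<and> j = 2 then 1 else 0 :: real^2^2"
  have "transpose ?P = ?P"
    by (simp add: transpose_def vec_eq_iff conj_commute)
  moreover have "0 \<le> y \<bullet> (?P *v y)" for y
    unfolding quadratic_form_2 by simp
  moreover have "trace ?P = 1"
    by (simp add: trace_def sum_2)
  ultimately show ?thesis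
    by (simp add: S1_def)
qed

text \<open>If \<open>B$2$2\<close> is positive, completing the square in the quadratic form of \<open>B\<close>
  writes \<open>B$2$2\<close> times \<open>B\<close> as the outer square of its second column plus the determinant times the
  outer square of the first basis vector. Each of the two contributes a nonnegative value of the
  quadratic form of \<open>A\<close>. If \<open>B$2$2\<close> is 0, only the entry \<open>B$1$1\<close> is left.\<close>

lemma frob_nonneg:
  assumes B: "B \<in> S1" and A: "\<And>y. 0 \<le> y \<bullet> (A *v y)"
  shows "0 \<le> frob B A"
proof -
  note S = S1_D[OF B]
  have q: "0 \<le> a * a * A$1$1 + a * b * (A$1$2 + A$2$1) + b * b * A$2$2" for a b
    using A[of "vector [a, b]"] by (simp add: quadratic_form_2)
  have "0 \<le> A$1$1"
    using q[of 1 0] by simp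
  show ?thesis
  proof (cases "B$2$2 = 0")
    case True
    then show ?thesis
      using S \<open>0 \<le> A$1$1\<close> by (simp add: frob_2)
  next
    case False
    have "B$2$2 * frob B A =
        (B$1$2 * B$1$2 * A$1$1 + B$1$2 * B$2$2 * (A$1$2 + A$2$1) + B$2$2 * B$2$2 * A$2$2)
        + (B$1$1 * B$2$2 - (B$1$2)\<^sup>2) * A$1$1"
      using S(1) by (simp add: frob_2 algebra_simps power2_eq_square)
    also have "\<dots> \<ge> 0"
    proof (rule add_nonneg_nonneg)
      show "0 \<le> (B$1$1 * B$2$2 - (B$1$2)\<^sup>2) * A$1$1"
        using S(5) \<open>0 \<le> A$1$1\<close> by simp
    qed (rule q)
    finally show ?thesis
      using False S(4) by (simp add: zero_le_mult_iff)
  qed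
qed

lemma bdd_above_frob: "bdd_above ((\<lambda>B. - frob B A) ` S1)"
proof (rule bdd_aboveI2)
  fix B assume "B \<in> S1"
  note S = S1_D[OF this]
  have "(B$1$2)\<^sup>2 \<le> 1\<^sup>2"
    using S mult_mono[of "B$1$1" 1 "B$2$2" 1] by auto
  then have "\<bar>B$1$2\<bar> \<le> 1"
    using abs_le_square_iff[of "B$1$2" 1] by simp
  have *: "- (b * a) \<le> \<bar>a\<bar>" if "\<bar>b\<bar> \<le> 1" for a b :: real
    using mult_right_mono[OF that abs_ge_zero[of a]] abs_ge_minus_self[of "b * a"]
    by (simp add: abs_mult)
  show "- frob B A \<le> \<bar>A$1$1\<bar> + \<bar>A$1$2\<bar> + \<bar>A$2$1\<bar> + \<bar>A$2$2\<bar>"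
    unfolding frob_2 minus_add_distrib
    by (intro add_mono *) (use S \<open>\<bar>B$1$2\<bar> \<le> 1\<close> in auto)
qed

lemma HJB_nonpos:
  assumes "\<And>y. 0 \<le> y \<bullet> (A *v y)"
  shows "HJB A \<le> 0"
  unfolding HJB_def
  using vertical_projection_in_S1 frob_nonneg[OF _ assms] by (intro cSUP_least) auto

text \<open>The projection onto the vertical direction competes in the supremum.\<close>

lemma HJB_nonneg:
  assumes "A$2$2 \<le> 0"
  shows "0 \<le> HJB A"
  unfolding HJB_def
  using assms by (intro cSUP_upper2[OF bdd_above_frob vertical_projection_in_S1]) (simp add: frob_2)

section \<open>The semicontinuous envelopes\<close>

lemma usc_env_eq:
  assumes x: "x \<in> closure Omega" and le: "\<And>y. y \<in> closure Omega \<Longrightarrow> v y \<le> a"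
    and eq: "\<And>y. y \<in> Omega \<Longrightarrow> v y = a"
  shows "usc_env v x = a"
proof -
  have "(SUP y\<in>seqs_to x. limsup (\<lambda>n. ereal (v (y n)))) = ereal a"
  proof (rule antisym)
    show "(SUP y\<in>seqs_to x. limsup (\<lambda>n. ereal (v (y n)))) \<le> ereal a"
      by (auto simp: seqs_to_def le intro!: SUP_least Limsup_bounded)
    obtain y where y: "\<And>n. y n \<in> Omega" "y \<longlonglongrightarrow> x"
      using x unfolding closure_sequential by blast
    then have "y \<in> seqs_to x"
      using closure_subset by (auto simp: seqs_to_def)
    then show "ereal a \<le> (SUP y\<in>seqs_to x. limsup (\<lambda>n. ereal (v (y n))))"
      by (rule SUP_upper2) (simp add: eq y Limsup_const)
  qed
  then show ?thesis
    by (simp add: usc_env_def)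
qed

lemma lsc_env_eq:
  assumes x: "x \<in> closure Omega"
    and lsc: "\<forall>\<^sub>F y in nhds x. y \<in> closure Omega \<longrightarrow> v x \<le> v y"
  shows "lsc_env v x = v x"
proof -
  have "(INF y\<in>seqs_to x. liminf (\<lambda>n. ereal (v (y n)))) = ereal (v x)"
  proof (rule antisym)
    have "(\<lambda>n. x) \<in> seqs_to x"
      using x by (simp add: seqs_to_def)
    then show "(INF y\<in>seqs_to x. liminf (\<lambda>n. ereal (v (y n)))) \<le> ereal (v x)"
      by (rule INF_lower2) (simp add: Liminf_const)
    show "ereal (v x) \<le> (INF y\<in>seqs_to x. liminf (\<lambda>n. ereal (v (y n))))"
    proof (rule INF_greatest, rule Liminf_bounded)
      fix y assume y: "y \<in> seqs_to x"
      then have "filterlim y (nhds x) sequentially"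
        by (simp add: seqs_to_def)
      from eventually_compose_filterlim[OF lsc this]
      show "\<forall>\<^sub>F n in sequentially. ereal (v x) \<le> ereal (v (y n))"
        using y by (simp add: seqs_to_def)
    qed
  qed
  then show ?thesis
    by (simp add: lsc_env_def)
qed

section \<open>The viscosity solution\<close>

theorem proposition5p1:
  fixes c :: real and v :: "real^2 \<Rightarrow> real"
  assumes "c > 0"
    and "\<forall>x \<in> Omega \<union> Gamma_N. v x = 0"
    and "\<forall>x \<in> closure Gamma_D. v x = - c"
  shows "closure Gamma_D \<union> Gamma_N = frontier Omega \<and> closure Gamma_D \<inter> Gamma_N = {} \<and>
    viscosity_solution v"
proof -
  have v: "v x = (if x$1 \<in> {0, 1} then - c else 0)" if "x \<in> closure Omega" for x
    using that assms(2,3) unfolding closure_Omega_partition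
    by (auto simp: closure_Gamma_D mem_Gamma_N mem_Omega)
  have bounded: "locally_bounded_on (closure Omega) v"
    unfolding locally_bounded_on_def
  proof (intro ballI exI conjI)
    fix x
    show "bounded (v ` (closure Omega \<inter> ball x 1))"
      by (rule bounded_subset[of "{0, - c}"]) (auto simp: v)
  qed simp
  have usc: "usc_env v x = 0" if "x \<in> closure Omega" for x
    using that assms by (intro usc_env_eq) (auto simp: v)
  have lsc: "lsc_env v x = v x" if x: "x \<in> closure Omega" for x
  proof (rule lsc_env_eq[OF x])
    show "\<forall>\<^sub>F y in nhds x. y \<in> closure Omega \<longrightarrow> v x \<le> v y"
    proof (cases "x \<in> closure Gamma_D")
      case True
      then show ?thesis
        using x \<open>c > 0\<close> by (auto simp: v closure_Gamma_D)
    next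
      case False
      then have "\<forall>\<^sub>F y in nhds x. y \<notin> closure Gamma_D"
        by (auto simp: eventually_nhds intro!: exI[of _ "- closure Gamma_D"])
      then show ?thesis
        by (rule eventually_mono) (use False x in \<open>auto simp: v closure_Gamma_D mem_closure_Omega\<close>)
    qed
  qed
  have "viscosity_subsolution v"
    unfolding viscosity_subsolution_def
  proof (intro conjI allI impI bounded)
    fix \<phi> g h x
    assume C2: "C2_closure \<phi> g h"
      and max: "local_max_on (closure Omega) (\<lambda>y. usc_env v y - \<phi> y) x"
    then have x: "x \<in> closure Omega"
      by (simp add: local_max_on_def)
    have min: "local_min_on (closure Omega) \<phi> x"
      using max by (auto simp: local_max_on_def local_min_on_def usc)
    have cvx: "convex (closure Omega)"
      by (simp add: closure_Omega)
    consider "x \<in> Omega" | "x \<in> Gamma_N" | "x \<in> closure Gamma_D" "x \<notin> Omega"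
      using x by (auto simp: closure_Omega_partition)
    then show "F_lower (h x) (g x) (usc_env v x) x \<le> 0"
    proof cases
      case 1
      \<comment> \<open>The condition is available for small multiples of \<open>y\<close>, which stay in the square; it is
        homogeneous of degree 2.\<close>
      have "0 \<le> y \<bullet> (h x *v y)" for y
      proof -
        have "((\<lambda>t. x + t *\<^sub>R y) \<longlongrightarrow> x + 0 *\<^sub>R y) (at_right 0)"
             "((\<lambda>t. x - t *\<^sub>R y) \<longlongrightarrow> x - 0 *\<^sub>R y) (at_right 0)"
          by (intro tendsto_intros)+
        then have "\<forall>\<^sub>F t in at_right 0. x + t *\<^sub>R y \<in> Omega"
          "\<forall>\<^sub>F t in at_right 0. x - t *\<^sub>R y \<in> Omega"
          using 1 open_Omega by (auto dest!: topological_tendstoD[where S = Omega])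
        moreover have "\<forall>\<^sub>F t in at_right (0::real). 0 < t"
          by (rule eventually_at_right_less)
        ultimately have "\<forall>\<^sub>F t in at_right (0::real). 0 \<le> y \<bullet> (h x *v y)"
        proof eventually_elim
          case (elim t)
          have "0 \<le> (t *\<^sub>R y) \<bullet> (h x *v (t *\<^sub>R y))"
            using elim closure_subset
            by (intro Hessian_at_local_min[OF C2 cvx order_refl min]) auto
          then show ?case
            using elim by (simp add: matrix_vector_mult_scaleR zero_le_mult_iff)
        qed
        then show ?thesis
          by simp
      qed
      then show ?thesis
        using 1 by (simp add: F_lower_def HJB_nonpos)
    next
      case 2
      then have "g x \<bullet> (- normal_N x) \<ge> 0"
        using x minus_normal_N(1)[OF x]
        by (intro gradient_at_local_min[OF C2 cvx order_refl min]) (auto simp: mem_Gamma_N)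
      then show ?thesis
        using 2 boundary_partition(2)
        by (auto simp: F_lower_def bdry_lower_def bdry_def mem_Gamma_N mem_Omega)
    next
      case 3
      then show ?thesis
        using x by (auto simp: F_lower_def bdry_lower_def bdry_def usc)
    qed
  qed
  moreover have "viscosity_supersolution v"
    unfolding viscosity_supersolution_def
  proof (intro conjI allI impI bounded)
    fix \<phi> g h x
    assume C2: "C2_closure \<phi> g h"
      and min: "local_min_on (closure Omega) (\<lambda>y. lsc_env v y - \<phi> y) x"
    then have x: "x \<in> closure Omega"
      by (simp add: local_min_on_def)
    \<comment> \<open>The vertical segment through \<open>x\<close>, on which the lower envelope is constant.\<close>
    define S where "S = closure Omega \<inter> {y. y$1 = x$1}"
    have S: "convex S" "S \<subseteq> closure Omega"
      using convex_hyperplane[of "axis 1 1 :: real^2" "x$1"]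
      by (auto simp: S_def closure_Omega inner_axis' intro!: convex_Int)
    have env: "lsc_env v y = v x" if "y \<in> S" for y
      using that x by (auto simp: S_def lsc v)
    have "x \<in> S"
      using x by (simp add: S_def)
    obtain e where "e > 0"
      and e: "\<And>y. y \<in> closure Omega \<inter> ball x e \<Longrightarrow> lsc_env v x - \<phi> x \<le> lsc_env v y - \<phi> y"
      using min by (auto simp: local_min_on_def)
    have "- \<phi> x \<le> - \<phi> y" if "y \<in> S \<inter> ball x e" for y
      using e[of y] that env[of y] env[of x] \<open>x \<in> S\<close> S(2) by auto
    then have minS: "local_min_on S (\<lambda>y. - \<phi> y) x"
      using \<open>x \<in> S\<close> \<open>e > 0\<close> by (auto simp: local_min_on_def)
    note C2' = C2_closure_minus[OF C2]
    consider "0 < x$2" "x$2 < 1" | "x$2 \<in> {0, 1}"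
      using x by (force simp: mem_closure_Omega)
    then show "F_upper (h x) (g x) (lsc_env v x) x \<ge> 0"
    proof cases
      case 1
      define r where "r = min (x$2) (1 - x$2)"
      let ?\<xi> = "axis 2 r :: real^2"
      have "x + ?\<xi> \<in> S" "x - ?\<xi> \<in> S"
        using 1 x by (auto simp: S_def mem_closure_Omega axis_def r_def)
      from Hessian_at_local_min[OF C2' S minS this]
      have "r * r * h x$2$2 \<le> 0"
        by (simp add: quadratic_form_2 axis_def)
      moreover have "r > 0"
        using 1 by (simp add: r_def)
      ultimately have "HJB (h x) \<ge> 0"
        by (intro HJB_nonneg) (simp add: mult_le_0_iff)
      then show ?thesis
        by (simp add: F_upper_def le_max_iff_disj)
    next
      case 2
      have "x + - normal_N x \<in> S"
        using minus_normal_N[OF x 2] by (simp add: S_def)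
      from gradient_at_local_min[OF C2' S minS this]
      have "0 \<le> g x \<bullet> normal_N x"
        by simp
      moreover have "x \<notin> Omega" "x \<notin> Gamma_D"
        using 2 by (auto simp: mem_Omega Gamma_D_def)
      ultimately show ?thesis
        using boundary_partition(2)
        by (auto simp: F_upper_def bdry_upper_def bdry_def)
    qed
  qed
  ultimately show ?thesis
    using boundary_partition by (simp add: viscosity_solution_def)
qed

end
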